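(* Let $\Lambda$ be a controllable linear system over $\mathbb{R}$ with flat output ${\bf y}=\{y_1,\dots,y_m\}$, and let $\mathcal{L}(y_1,\dot y_1,\dots,y_1^{(\mu_1)},\dots,y_m,\dot y_m,\dots,y_m^{(\mu_m)})\in S(\Lambda)$ be a Lagrangian. If $\mathcal{L}$ is quadratic, then the Euler-Lagrange system $$\frac{\partial \mathcal{L}}{\partial y_\iota}-\frac{d}{dt}\frac{\partial\mathcal{L}}{\partial\dot y_\iota}+\dots+(-1)^{\mu_\iota}\frac{d^{\mu_\iota}}{dt^{\mu_\iota}}\frac{\partial\mathcal{L}}{\partial y_\iota^{(\mu_\iota)}}=0,\qquad \iota=1,\dots,m,$$ is a system of homogeneous linear ordinary differential equations in $y_1,\dots,y_m$ with constant coefficients in $\mathbb{R}$.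
   Context: A linear system over $\mathbb{R}$ is a finitely generated $\mathbb{R}[\frac{d}{dt}]$-module $\Lambda$, where $\mathbb{R}[\frac{d}{dt}]$ is the (polynomial) ring of linear differential operators with constant coefficients. It is controllable if it is a free module; a flat output is a basis of this free module. A Lagrangian is an element of the symmetric algebra $S(\Lambda)=\bigoplus_{\nu\ge0}S^\nu(\Lambda)$ of $\Lambda$ over $\mathbb{R}$ (as a real vector space), equipped with the derivation $\frac{d}{dt}$ extending that of $\Lambda$ and vanishing on $\mathbb{R}$. If ${\bf y}$ is a flat output, $S(\Lambda)$ is the polynomial ring $\mathbb{R}[y_\iota^{(\nu)}\mid 1\le\iota\le m,\ \nu\ge0]$ in infinitely many variables, with derivation $\frac{d}{dt}y_\iota^{(\nu)}=y_\iota^{(\nu+1)}$. The Lagrangian $\mathcal{L}$ is called quadratic if $\mathcal{L}\in S^2(\Lambda)$. *)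

theory Defs
  imports
    Complex_Main
    "HOL-Library.Multiset"
    "HOL-Library.Poly_Mapping"
    "HOL-Computational_Algebra.Polynomial"
begin

section \<open>The symmetric algebra of a real vector space\<close>

text \<open>
  A finitely supported function from multisets over \<open>'a\<close> to the reals is a polynomial whose
  indeterminates are the elements of \<open>'a\<close>: the multiset records the factors of a monomial, so that
  adding multisets multiplies monomials, and the ring operations are those of
  \<^theory>\<open>HOL-Library.Poly_Mapping\<close>. The symmetric algebra is the quotient of this ring by the
  ideal that makes the indeterminates depend linearly on the vectors.
\<close>

type_synonym 'a vpoly = "'a multiset \<Rightarrow>\<^sub>0 real"

definition ring_ideal :: "'r::comm_ring_1 set \<Rightarrow> 'r set" where
  "ring_ideal G = module.span (*) G"

definition vvar :: "'a \<Rightarrow> 'a vpoly" where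
  "vvar x = Poly_Mapping.single {#x#} 1"

definition vconst :: "real \<Rightarrow> 'a vpoly" where
  "vconst c = Poly_Mapping.single {#} c"

definition sym_relators :: "'a::real_vector vpoly set" where
  "sym_relators =
     {vvar (x + y) - (vvar x + vvar y) | x y. True} \<union>
     {vvar (c *\<^sub>R x) - vconst c * vvar x | c x. True}"

lemma module_mult: "module ((*) :: 'r::comm_ring_1 \<Rightarrow> 'r \<Rightarrow> 'r)"
  by standard (simp_all add: algebra_simps)

lemma ring_ideal_0: "0 \<in> ring_ideal G"
  unfolding ring_ideal_def by (rule module.span_zero[OF module_mult])

lemma ring_ideal_add: "a \<in> ring_ideal G \<Longrightarrow> b \<in> ring_ideal G \<Longrightarrow> a + b \<in> ring_ideal G"
  unfolding ring_ideal_def by (rule module.span_add[OF module_mult])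

lemma ring_ideal_diff: "a \<in> ring_ideal G \<Longrightarrow> b \<in> ring_ideal G \<Longrightarrow> a - b \<in> ring_ideal G"
  unfolding ring_ideal_def by (rule module.span_diff[OF module_mult])

lemma ring_ideal_neg: "a \<in> ring_ideal G \<Longrightarrow> - a \<in> ring_ideal G"
  unfolding ring_ideal_def by (rule module.span_neg[OF module_mult])

lemma ring_ideal_mult: "a \<in> ring_ideal G \<Longrightarrow> c * a \<in> ring_ideal G"
  unfolding ring_ideal_def by (rule module.span_scale[OF module_mult])

lemma ring_ideal_base: "a \<in> G \<Longrightarrow> a \<in> ring_ideal G"
  unfolding ring_ideal_def by (rule module.span_base[OF module_mult])

lemma ring_ideal_induct [consumes 1, case_names zero step]:
  assumes "a \<in> ring_ideal G"
    and "P 0" and "\<And>c g b. g \<in> G \<Longrightarrow> P b \<Longrightarrow> P (c * g + b)"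
  shows "P a"
  using assms unfolding ring_ideal_def
  by (rule module.span_induct_alt[OF module_mult])

quotient_type (overloaded) 'a sym_alg =
  "'a::real_vector multiset \<Rightarrow>\<^sub>0 real" / "\<lambda>p q. p - q \<in> ring_ideal sym_relators"
proof (rule equivpI)
  show "reflp (\<lambda>p q. p - q \<in> ring_ideal sym_relators)"
    by (rule reflpI) (simp add: ring_ideal_0)
  show "symp (\<lambda>p q. p - q \<in> ring_ideal sym_relators)"
    by (rule sympI) (use ring_ideal_neg in fastforce)
  show "transp (\<lambda>p q. p - q \<in> ring_ideal sym_relators)"
    by (rule transpI) (use ring_ideal_add in fastforce)
qed

lemma lookup_vpoly_mult_empty:
  fixes p q :: "'a vpoly"
  shows "Poly_Mapping.lookup (p * q) {#} = Poly_Mapping.lookup p {#} * Poly_Mapping.lookup q {#}"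
proof -
  have eq: "(\<Sum>r. Poly_Mapping.lookup q r when {#} = k + r)
      = (Poly_Mapping.lookup q {#} when k = {#})" for k :: "'a multiset"
  proof (cases "k = {#}")
    case True
    then show ?thesis by (simp add: eq_commute[of "{#}"])
  next
    case False
    then have "\<And>r. {#} \<noteq> k + r" by auto
    then show ?thesis using False by simp
  qed
  show ?thesis
    by (simp only: lookup_mult eq mult_when) (simp add: Sum_any_when_equal)
qed

lemma ring_ideal_sym_lookup_empty:
  "p \<in> ring_ideal sym_relators \<Longrightarrow> Poly_Mapping.lookup p {#} = 0"
proof (induction rule: ring_ideal_induct)
  case (step c g b)
  then have "Poly_Mapping.lookup g {#} = 0"
    by (auto simp: sym_relators_def vvar_def vconst_def lookup_minus lookup_add lookup_single
        lookup_vpoly_mult_empty)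
  with step show ?case by (simp add: lookup_add lookup_vpoly_mult_empty)
qed simp

instantiation sym_alg :: (real_vector) comm_ring_1
begin

lift_definition zero_sym_alg :: "'a sym_alg" is 0 .
lift_definition one_sym_alg :: "'a sym_alg" is 1 .
lift_definition plus_sym_alg :: "'a sym_alg \<Rightarrow> 'a sym_alg \<Rightarrow> 'a sym_alg" is "(+)"
  by (drule (1) ring_ideal_add) (simp add: algebra_simps)
lift_definition minus_sym_alg :: "'a sym_alg \<Rightarrow> 'a sym_alg \<Rightarrow> 'a sym_alg" is "(-)"
  by (drule (1) ring_ideal_diff) (simp add: algebra_simps)
lift_definition uminus_sym_alg :: "'a sym_alg \<Rightarrow> 'a sym_alg" is uminus
  by (drule ring_ideal_neg) (simp add: algebra_simps)
lift_definition times_sym_alg :: "'a sym_alg \<Rightarrow> 'a sym_alg \<Rightarrow> 'a sym_alg" is "(*)"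
proof -
  fix p p' q q' :: "'a multiset \<Rightarrow>\<^sub>0 real"
  assume "p - p' \<in> ring_ideal sym_relators" "q - q' \<in> ring_ideal sym_relators"
  then have "q * (p - p') + p' * (q - q') \<in> ring_ideal sym_relators"
    by (intro ring_ideal_add ring_ideal_mult)
  then show "p * q - p' * q' \<in> ring_ideal sym_relators"
    by (simp add: algebra_simps)
qed

instance
proof
  show "(0 :: 'a sym_alg) \<noteq> 1"
    by transfer (auto dest: ring_ideal_sym_lookup_empty simp: lookup_minus lookup_one)
qed (transfer, simp add: algebra_simps ring_ideal_0)+

end

lemma vconst_1: "vconst 1 = 1"
  unfolding vconst_def zero_multiset_def[symmetric] by (rule single_one)

instantiation sym_alg :: (real_vector) real_algebra_1
begin

lift_definition scaleR_sym_alg :: "real \<Rightarrow> 'a sym_alg \<Rightarrow> 'a sym_alg" is "\<lambda>c p. vconst c * p"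
  by (drule ring_ideal_mult) (simp add: algebra_simps)

instance
proof
  fix a b :: real and x y :: "'a sym_alg"
  show "a *\<^sub>R (x + y) = a *\<^sub>R x + a *\<^sub>R y"
    by transfer (simp add: algebra_simps ring_ideal_0)
  show "(a + b) *\<^sub>R x = a *\<^sub>R x + b *\<^sub>R x"
    by transfer (simp add: algebra_simps ring_ideal_0 vconst_def single_add)
  show "a *\<^sub>R b *\<^sub>R x = (a * b) *\<^sub>R x"
    by transfer (simp add: ring_ideal_0 vconst_def mult_single mult.assoc[symmetric])
  show "1 *\<^sub>R x = x"
    by transfer (simp add: ring_ideal_0 vconst_1)
  show "a *\<^sub>R x * y = a *\<^sub>R (x * y)"
    by transfer (simp add: ring_ideal_0 mult.assoc)
  show "x * a *\<^sub>R y = a *\<^sub>R (x * y)"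
    by transfer (simp add: ring_ideal_0 mult.left_commute)
qed

end

lift_definition sym_incl :: "'a::real_vector \<Rightarrow> 'a sym_alg" is vvar .

lemma linear_sym_incl: "linear (sym_incl :: 'a::real_vector \<Rightarrow> 'a sym_alg)"
proof (rule linearI)
  show "sym_incl (x + y) = sym_incl x + sym_incl y" for x y :: 'a
    by transfer (rule ring_ideal_base, auto simp: sym_relators_def)
  show "sym_incl (c *\<^sub>R x) = c *\<^sub>R sym_incl x" for c and x :: 'a
    by transfer (rule ring_ideal_base, auto simp: sym_relators_def)
qed

definition sym_power :: "nat \<Rightarrow> 'a::real_vector sym_alg set" where
  "sym_power n = span {prod_list (map sym_incl xs) | xs. length xs = n}"

inductive_set subalgebra_generated :: "'b::real_algebra_1 set \<Rightarrow> 'b set" for X where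
  "of_real c \<in> subalgebra_generated X"
| "x \<in> X \<Longrightarrow> x \<in> subalgebra_generated X"
| "a \<in> subalgebra_generated X \<Longrightarrow> b \<in> subalgebra_generated X \<Longrightarrow> a + b \<in> subalgebra_generated X"
| "a \<in> subalgebra_generated X \<Longrightarrow> b \<in> subalgebra_generated X \<Longrightarrow> a * b \<in> subalgebra_generated X"


section \<open>Derivations of the symmetric algebra\<close>

definition derivation :: "('b::real_algebra_1 \<Rightarrow> 'b) \<Rightarrow> bool" where
  "derivation \<delta> \<longleftrightarrow> linear \<delta> \<and> (\<forall>a b. \<delta> (a * b) = \<delta> a * b + a * \<delta> b)"

lemma vpoly_sum_single:
  fixes p :: "'a vpoly"
  shows "p = (\<Sum>M\<in>Poly_Mapping.keys p. Poly_Mapping.single M (Poly_Mapping.lookup p M))"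
proof (rule poly_mapping_eqI)
  fix K
  have "(\<Sum>M\<in>Poly_Mapping.keys p. Poly_Mapping.lookup p M when M = K)
      = Poly_Mapping.lookup p K"
    by (simp add: when_def sum.delta in_keys_iff)
  then show "Poly_Mapping.lookup p K =
      Poly_Mapping.lookup (\<Sum>M\<in>Poly_Mapping.keys p. Poly_Mapping.single M (Poly_Mapping.lookup p M)) K"
    by (simp add: lookup_sum lookup_single)
qed

lemma vpoly_induct [case_names const var add mult]:
  fixes p :: "'a vpoly"
  assumes "\<And>c. P (vconst c)" and "\<And>x. P (vvar x)"
    and add: "\<And>a b. P a \<Longrightarrow> P b \<Longrightarrow> P (a + b)" and mult: "\<And>a b. P a \<Longrightarrow> P b \<Longrightarrow> P (a * b)"
  shows "P p"
proof -
  have mono: "P (Poly_Mapping.single M c)" for M c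
  proof (induction M)
    case empty
    then show ?case using assms(1)[of c] by (simp add: vconst_def)
  next
    case (add x M)
    have "vvar x * Poly_Mapping.single M c = Poly_Mapping.single (add_mset x M) c"
      by (simp add: vvar_def mult_single)
    then show ?case using mult[OF assms(2)[of x] add] by simp
  qed
  have zero: "P 0" using mono[of _ 0] by simp
  have "P (\<Sum>M\<in>A. Poly_Mapping.single M (Poly_Mapping.lookup p M))" for A
    by (induction A rule: infinite_finite_induct) (auto intro: zero add mono)
  then show ?thesis by (subst vpoly_sum_single)
qed

lemma abs_vconst: "abs_sym_alg (vconst c) = of_real c"
proof -
  have "c *\<^sub>R (1 :: 'a sym_alg) = abs_sym_alg (vconst c)"
    by (simp add: one_sym_alg_def scaleR_sym_alg.abs_eq)
  then show ?thesis by (simp add: of_real_def)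
qed

lemma abs_vvar: "abs_sym_alg (vvar x) = sym_incl x"
  by (simp add: sym_incl.abs_eq)

lemma sym_alg_generated: "subalgebra_generated (range sym_incl) = (UNIV :: 'a::real_vector sym_alg set)"
proof -
  have "abs_sym_alg p \<in> subalgebra_generated (range sym_incl)" for p :: "'a multiset \<Rightarrow>\<^sub>0 real"
  proof (induction p rule: vpoly_induct)
    case (const c)
    then show ?case unfolding abs_vconst by (rule subalgebra_generated.intros)
  next
    case (var x)
    then show ?case unfolding abs_vvar by (rule subalgebra_generated.intros) simp
  next
    case (add a b)
    then show ?case unfolding plus_sym_alg.abs_eq[symmetric] by (rule subalgebra_generated.intros)
  next
    case (mult a b)
    then show ?case unfolding times_sym_alg.abs_eq[symmetric] by (rule subalgebra_generated.intros)
  qed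
  then show ?thesis using Quotient_abs_rep[OF Quotient_sym_alg] by (metis UNIV_eq_I)
qed

lemma derivation_of_real:
  assumes "derivation \<delta>"
  shows "\<delta> (of_real c) = 0"
proof -
  have "\<delta> (1 * 1) = \<delta> 1 + \<delta> 1" using assms unfolding derivation_def by (metis mult_1 mult_1_right)
  then have "\<delta> 1 = 0" by simp
  then show ?thesis using assms by (simp add: derivation_def of_real_def linear_cmul)
qed

lemma derivation_unique:
  fixes \<delta> \<delta>' :: "'a::real_vector sym_alg \<Rightarrow> 'a sym_alg"
  assumes "derivation \<delta>" "derivation \<delta>'" "\<And>x. \<delta> (sym_incl x) = \<delta>' (sym_incl x)"
  shows "\<delta> = \<delta>'"
proof
  fix a :: "'a sym_alg"
  have "a \<in> subalgebra_generated (range sym_incl)" by (simp add: sym_alg_generated)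
  then show "\<delta> a = \<delta>' a"
    by induction (use assms in \<open>auto simp: derivation_of_real derivation_def linear_add\<close>)
qed

definition vpoly_lift :: "('a multiset \<Rightarrow> 'b::real_vector) \<Rightarrow> 'a vpoly \<Rightarrow> 'b" where
  "vpoly_lift \<phi> p = (\<Sum>M\<in>Poly_Mapping.keys p. Poly_Mapping.lookup p M *\<^sub>R \<phi> M)"

lemma vpoly_lift_superset:
  "finite A \<Longrightarrow> Poly_Mapping.keys p \<subseteq> A \<Longrightarrow>
     vpoly_lift \<phi> p = (\<Sum>M\<in>A. Poly_Mapping.lookup p M *\<^sub>R \<phi> M)"
  unfolding vpoly_lift_def by (rule sum.mono_neutral_left) (auto simp: in_keys_iff)

lemma vpoly_lift_add: "vpoly_lift \<phi> (p + q) = vpoly_lift \<phi> p + vpoly_lift \<phi> q"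
proof -
  define A where "A = Poly_Mapping.keys p \<union> Poly_Mapping.keys q"
  have A: "finite A" "Poly_Mapping.keys p \<subseteq> A" "Poly_Mapping.keys q \<subseteq> A"
    "Poly_Mapping.keys (p + q) \<subseteq> A"
    unfolding A_def using Poly_Mapping.keys_add[of p q] by auto
  show ?thesis
    by (simp add: vpoly_lift_superset[OF A(1,2)] vpoly_lift_superset[OF A(1,3)]
        vpoly_lift_superset[OF A(1,4)] lookup_add scaleR_left_distrib sum.distrib)
qed

lemma vpoly_lift_single: "vpoly_lift \<phi> (Poly_Mapping.single M c) = c *\<^sub>R \<phi> M"
  by (simp add: vpoly_lift_def)

lemma vpoly_lift_diff: "vpoly_lift \<phi> (p - q) = vpoly_lift \<phi> p - vpoly_lift \<phi> q"
  using vpoly_lift_add[of \<phi> "p - q" q] by simp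

lemma vpoly_lift_0: "vpoly_lift \<phi> 0 = 0"
  by (simp add: vpoly_lift_def)

lemma derivation_exists:
  fixes f :: "'a::real_vector \<Rightarrow> 'a sym_alg"
  assumes f: "linear f"
  shows "\<exists>\<delta>. derivation \<delta> \<and> (\<forall>x. \<delta> (sym_incl x) = f x)"
proof -
  define \<pi> :: "'a multiset \<Rightarrow> 'a sym_alg" where "\<pi> M = (\<Prod>x\<in>#M. sym_incl x)" for M
  define \<phi> where "\<phi> M = (\<Sum>x\<in>#M. f x * \<pi> (M - {#x#}))" for M
  define d where "d = vpoly_lift \<phi>"
  have \<pi>_add: "\<pi> (M + N) = \<pi> M * \<pi> N" for M N
    by (simp add: \<pi>_def)
  have abs_single: "abs_sym_alg (Poly_Mapping.single M c) = c *\<^sub>R \<pi> M" for M c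
  proof (induction M)
    case empty
    then show ?case using abs_vconst[of c, where 'a='a] by (simp add: \<pi>_def vconst_def of_real_def)
  next
    case (add x M)
    have "Poly_Mapping.single (add_mset x M) c = vvar x * Poly_Mapping.single M c"
      by (simp add: vvar_def mult_single)
    then have "abs_sym_alg (Poly_Mapping.single (add_mset x M) c)
        = sym_incl x * abs_sym_alg (Poly_Mapping.single M c)"
      by (simp add: times_sym_alg.abs_eq[symmetric] abs_vvar)
    then show ?case using add by (simp add: \<pi>_def)
  qed
  have \<phi>_add_mset: "\<phi> (add_mset a M) = f a * \<pi> M + sym_incl a * \<phi> M" for a M
  proof -
    have "(\<Sum>x\<in>#M. f x * \<pi> (add_mset a M - {#x#}))
        = (\<Sum>x\<in>#M. sym_incl a * (f x * \<pi> (M - {#x#})))"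
    proof (rule arg_cong[of _ _ sum_mset], rule image_mset_cong)
      fix x assume "x \<in># M"
      then have "add_mset a M - {#x#} = add_mset a (M - {#x#})" by simp
      then show "f x * \<pi> (add_mset a M - {#x#}) = sym_incl a * (f x * \<pi> (M - {#x#}))"
        by (simp add: \<pi>_def mult.left_commute)
    qed
    then show ?thesis by (simp add: \<phi>_def sum_mset_distrib_left)
  qed
  have \<phi>_add: "\<phi> (M + N) = \<phi> M * \<pi> N + \<pi> M * \<phi> N" for M N
  proof (induction M)
    case empty
    then show ?case by (simp add: \<phi>_def \<pi>_def)
  next
    case (add a M)
    have "\<phi> (add_mset a M + N) = f a * \<pi> (M + N) + sym_incl a * \<phi> (M + N)"
      using \<phi>_add_mset[of a "M + N"] by simp
    moreover have "\<pi> (add_mset a M) = sym_incl a * \<pi> M" by (simp add: \<pi>_def)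
    ultimately show ?case using add by (simp add: \<phi>_add_mset \<pi>_add algebra_simps)
  qed
  note d_simps = d_def vpoly_lift_add vpoly_lift_diff vpoly_lift_0 vpoly_lift_single
  have d_mult_single: "d (Poly_Mapping.single M c * Poly_Mapping.single N e)
      = d (Poly_Mapping.single M c) * abs_sym_alg (Poly_Mapping.single N e)
        + abs_sym_alg (Poly_Mapping.single M c) * d (Poly_Mapping.single N e)" for M N c e
    by (simp add: d_simps mult_single abs_single \<phi>_add scaleR_right_distrib mult.commute)
  let ?Q = "\<lambda>p q. d (p * q) = d p * abs_sym_alg q + abs_sym_alg p * d q"
  have abs_0: "abs_sym_alg 0 = (0 :: 'a sym_alg)" by (simp add: zero_sym_alg_def)
  have Q_add_left: "?Q (p + p') q" if "?Q p q" "?Q p' q" for p p' q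
    using that by (simp add: d_simps plus_sym_alg.abs_eq[symmetric] algebra_simps)
  have Q_add_right: "?Q p (q + q')" if "?Q p q" "?Q p q'" for p q q'
    using that by (simp add: d_simps plus_sym_alg.abs_eq[symmetric] algebra_simps)
  have Q_0: "?Q 0 q" "?Q p 0" for p q
    by (simp_all add: d_simps abs_0)
  have Q1: "?Q (Poly_Mapping.single M c) (\<Sum>N\<in>A. Poly_Mapping.single N (e N))" for M c A e
    by (induction A rule: infinite_finite_induct)
      (simp_all only: sum.infinite sum.empty sum.insert Q_0 Q_add_right d_mult_single not_False_eq_True)
  have Q2: "?Q (\<Sum>M\<in>B. Poly_Mapping.single M (c M)) (\<Sum>N\<in>A. Poly_Mapping.single N (e N))" for B c A e
    by (induction B rule: infinite_finite_induct)
      (simp_all only: sum.infinite sum.empty sum.insert Q_0 Q_add_left Q1 not_False_eq_True)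
  have d_mult: "?Q p q" for p q
    using Q2[of "Poly_Mapping.lookup p" "Poly_Mapping.keys p"
        "Poly_Mapping.lookup q" "Poly_Mapping.keys q"]
    by (simp only: vpoly_sum_single[symmetric])
  have d_vvar: "d (vvar x) = f x" for x
    by (simp add: vvar_def d_simps \<phi>_def \<pi>_def)
  have d_vconst: "d (vconst c) = 0" for c
    by (simp add: vconst_def d_simps \<phi>_def)
  have d_relator: "d g = 0" "abs_sym_alg g = 0" if "g \<in> sym_relators" for g
  proof -
    have d_add: "d (p + q) = d p + d q" and d_diff: "d (p - q) = d p - d q" for p q
      by (simp_all add: d_simps)
    show "d g = 0"
      using that unfolding sym_relators_def
      by (auto simp: d_add d_diff d_mult d_vconst d_vvar abs_vconst linear_add[OF f]
          linear_cmul[OF f] scaleR_conv_of_real)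
    have "abs_sym_alg g = abs_sym_alg 0"
      using that by (simp add: sym_alg.abs_eq_iff ring_ideal_base)
    then show "abs_sym_alg g = 0" by (simp add: abs_0)
  qed
  have d_ideal: "d p = 0" if "p \<in> ring_ideal sym_relators" for p
    using that
  proof (induction rule: ring_ideal_induct)
    case zero
    then show ?case by (simp add: d_simps)
  next
    case (step c g b)
    have "d (c * g + b) = d (c * g) + d b" by (simp add: d_simps)
    then show ?case using step by (simp add: d_mult d_relator)
  qed
  have d_cong: "d p = d q" if "abs_sym_alg p = abs_sym_alg q" for p q
  proof -
    have "d (p - q) = 0" using that by (intro d_ideal) (simp add: sym_alg.abs_eq_iff)
    then show ?thesis by (simp add: d_simps)
  qed
  define \<delta> where "\<delta> a = d (rep_sym_alg a)" for a
  have \<delta>_abs: "\<delta> (abs_sym_alg p) = d p" for p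
    unfolding \<delta>_def by (rule d_cong) (simp add: Quotient_abs_rep[OF Quotient_sym_alg])
  have ex_rep: "\<exists>p. a = abs_sym_alg p" for a :: "'a sym_alg"
    by (metis Quotient_abs_rep[OF Quotient_sym_alg])
  have mult: "\<delta> (a * b) = \<delta> a * b + a * \<delta> b" for a b
    using ex_rep[of a] ex_rep[of b] by (auto simp: times_sym_alg.abs_eq \<delta>_abs d_mult)
  have add: "\<delta> (a + b) = \<delta> a + \<delta> b" for a b
    using ex_rep[of a] ex_rep[of b] by (auto simp: plus_sym_alg.abs_eq \<delta>_abs d_simps)
  have const: "\<delta> (of_real c) = 0" for c
    by (simp add: abs_vconst[symmetric] \<delta>_abs d_vconst)
  have "linear \<delta>"
    by (rule linearI) (simp_all add: add scaleR_conv_of_real mult const)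
  moreover have "\<delta> (sym_incl x) = f x" for x
    by (simp add: abs_vvar[symmetric] \<delta>_abs d_vvar)
  ultimately show ?thesis using mult unfolding derivation_def by blast
qed

lemma derivation_ex1:
  fixes f :: "'a::real_vector \<Rightarrow> 'a sym_alg"
  assumes "linear f"
  shows "\<exists>!\<delta>. derivation \<delta> \<and> (\<forall>x. \<delta> (sym_incl x) = f x)"
proof -
  obtain \<delta> where \<delta>: "derivation \<delta> \<and> (\<forall>x. \<delta> (sym_incl x) = f x)"
    using derivation_exists[OF assms] by (rule exE)
  show ?thesis
  proof (rule ex1I)
    show "derivation \<delta> \<and> (\<forall>x. \<delta> (sym_incl x) = f x)" by (rule \<delta>)
    fix \<delta>'
    assume *: "derivation \<delta>' \<and> (\<forall>x. \<delta>' (sym_incl x) = f x)"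
    have "\<delta>' (sym_incl x) = \<delta> (sym_incl x)" for x
      by (simp only: conjunct2[OF *, THEN spec] conjunct2[OF \<delta>, THEN spec])
    then show "\<delta>' = \<delta>"
      by (rule derivation_unique[OF conjunct1[OF *] conjunct1[OF \<delta>]])
  qed
qed


section \<open>Linear systems and the Euler-Lagrange expressions\<close>

text \<open>
  The indeterminate of \<^typ>\<open>real poly\<close> plays the role of the operator \<open>d/dt\<close>. The real vector
  space underlying the module is the one of the type class; \<open>smul_const\<close> says that it is the
  restriction of scalars to constant operators.
\<close>

locale linear_system = module smul
  for smul :: "real poly \<Rightarrow> 'a::real_vector \<Rightarrow> 'a" +
  assumes smul_const: "smul [:c:] x = c *\<^sub>R x"
    and finitely_generated: "\<exists>G. finite G \<and> module.span smul G = UNIV"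
begin

definition ddt :: "'a \<Rightarrow> 'a" where
  "ddt x = smul [:0, 1:] x"

definition controllable :: bool where
  "controllable \<longleftrightarrow> (\<exists>B. independent B \<and> span B = UNIV)"

definition flat_output :: "nat \<Rightarrow> (nat \<Rightarrow> 'a) \<Rightarrow> bool" where
  "flat_output m y \<longleftrightarrow>
     inj_on y {1..m} \<and> independent (y ` {1..m}) \<and> span (y ` {1..m}) = UNIV"

definition jet :: "(nat \<Rightarrow> 'a) \<Rightarrow> nat \<Rightarrow> nat \<Rightarrow> 'a sym_alg" where
  "jet y j k = sym_incl ((ddt ^^ k) (y j))"

definition ddt_sym :: "'a sym_alg \<Rightarrow> 'a sym_alg" where
  "ddt_sym = (THE \<delta>. derivation \<delta> \<and> (\<forall>x. \<delta> (sym_incl x) = sym_incl (ddt x)))"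

text \<open>
  The partial derivative with respect to the \<open>k\<close>-th derivative of \<open>y i\<close>. Lemma
  \<open>partial_jet_ex1\<close> below shows that the description is proper when \<open>y\<close> is a flat output.
\<close>

definition partial_jet :: "nat \<Rightarrow> (nat \<Rightarrow> 'a) \<Rightarrow> nat \<Rightarrow> nat \<Rightarrow> 'a sym_alg \<Rightarrow> 'a sym_alg" where
  "partial_jet m y i k =
     (THE \<delta>. derivation \<delta> \<and>
        (\<forall>j\<in>{1..m}. \<forall>l. \<delta> (jet y j l) = (if j = i \<and> l = k then 1 else 0)))"

definition euler_lagrange ::
  "nat \<Rightarrow> (nat \<Rightarrow> 'a) \<Rightarrow> (nat \<Rightarrow> nat) \<Rightarrow> 'a sym_alg \<Rightarrow> nat \<Rightarrow> 'a sym_alg" where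
  "euler_lagrange m y \<mu> L i =
     (\<Sum>k\<le>\<mu> i. (-1) ^ k * (ddt_sym ^^ k) (partial_jet m y i k L))"

text \<open>The equations \<open>E i = 0\<close> form a homogeneous linear system with constant coefficients.\<close>

definition homogeneous_linear_const_system ::
  "nat \<Rightarrow> (nat \<Rightarrow> 'a) \<Rightarrow> (nat \<Rightarrow> 'a sym_alg) \<Rightarrow> bool" where
  "homogeneous_linear_const_system m y E \<longleftrightarrow>
     (\<forall>i\<in>{1..m}. \<exists>(N::nat) (a :: nat \<Rightarrow> nat \<Rightarrow> real).
        E i = (\<Sum>j=1..m. \<Sum>k\<le>N. a j k *\<^sub>R jet y j k))"

lemma linear_ddt: "linear ddt"
proof (rule linearI)
  show "ddt (x + z) = ddt x + ddt z" for x z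
    by (simp add: ddt_def scale_right_distrib)
  show "ddt (c *\<^sub>R x) = c *\<^sub>R ddt x" for c x
    by (simp add: ddt_def smul_const[symmetric])
qed

lemma ddt_sym_ex1: "\<exists>!\<delta>. derivation \<delta> \<and> (\<forall>x. \<delta> (sym_incl x) = sym_incl (ddt x))"
  by (rule derivation_ex1) (rule linear_compose[OF linear_ddt linear_sym_incl, unfolded o_def])

lemma ddt_power: "(ddt ^^ k) x = smul (monom 1 k) x"
proof (induction k)
  case 0
  then show ?case by (simp add: monom_0 one_pCons[symmetric])
next
  case (Suc k)
  then show ?case by (simp add: ddt_def monom_Suc)
qed

lemma partial_jet_ex1:
  assumes y: "flat_output m y" and i: "i \<in> {1..m}"
  shows "\<exists>!\<delta>. derivation \<delta> \<and>
     (\<forall>j\<in>{1..m}. \<forall>l. \<delta> (jet y j l) = (if j = i \<and> l = k then 1 else 0))"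
proof -
  let ?B = "y ` {1..m}"
  let ?R = "\<lambda>x. representation ?B x (y i)"
  have ind: "independent ?B" and sp: "\<And>x. x \<in> span ?B" and inj: "inj_on y {1..m}"
    using y unfolding flat_output_def by auto
  define f where "f x = (of_real (coeff (?R x) k) :: 'a sym_alg)" for x
  have f: "linear f"
  proof (rule linearI)
    show "f (x + z) = f x + f z" for x z
      unfolding f_def representation_add[OF ind sp sp] by simp
    show "f (c *\<^sub>R x) = c *\<^sub>R f x" for c x
      unfolding f_def smul_const[symmetric] representation_scale[OF ind sp]
      by (simp add: scaleR_conv_of_real)
  qed
  have f_jet: "f ((ddt ^^ l) (y j)) = (if j = i \<and> l = k then 1 else 0)" if j: "j \<in> {1..m}" for j l
  proof -
    have eq: "y j = y i \<longleftrightarrow> j = i"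
      using inj_on_eq_iff[OF inj j i] .
    have "y j \<in> ?B" using j by (rule imageI)
    then have "?R (y j) = (if j = i then 1 else 0)"
      by (simp only: representation_basis[OF ind] eq eq_commute[of "y i"])
    then show ?thesis
      by (simp only: f_def ddt_power representation_scale[OF ind sp]) simp
  qed
  obtain \<delta> where \<delta>: "derivation \<delta>" "\<And>x. \<delta> (sym_incl x) = f x"
    using derivation_exists[OF f] by blast
  show ?thesis
  proof (rule ex1I)
    show "derivation \<delta> \<and> (\<forall>j\<in>{1..m}. \<forall>l. \<delta> (jet y j l) = (if j = i \<and> l = k then 1 else 0))"
      using \<delta> f_jet by (simp add: jet_def)
  next
    fix \<delta>'
    assume *: "derivation \<delta>' \<and> (\<forall>j\<in>{1..m}. \<forall>l. \<delta>' (jet y j l) = (if j = i \<and> l = k then 1 else 0))"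
    define g where "g x = \<delta>' (sym_incl x)" for x
    have g: "linear g"
      using * linear_compose[OF linear_sym_incl, of \<delta>'] by (simp add: g_def[abs_def] o_def derivation_def)
    have basis: "g (smul p (y j)) = f (smul p (y j))" if j: "j \<in> {1..m}" for p j
    proof -
      have mono: "g (smul (monom c l) (y j)) = f (smul (monom c l) (y j))" for c l
      proof -
        have "smul (monom c l) (y j) = c *\<^sub>R (ddt ^^ l) (y j)"
          by (simp add: ddt_power smul_const[symmetric] smult_monom)
        then show ?thesis
          using * j by (simp add: linear_cmul[OF f] linear_cmul[OF g] f_jet)
            (simp add: g_def jet_def)
      qed
      have "smul p (y j) = (\<Sum>l\<le>degree p. smul (monom (coeff p l) l) (y j))"
        by (subst poly_as_sum_of_monoms[symmetric]) (simp only: scale_sum_left)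
      then show ?thesis by (simp add: linear_sum[OF f] linear_sum[OF g] mono)
    qed
    have "g x = f x" for x
      using sp[of x]
    proof (induction rule: span_induct_alt)
      case base
      then show ?case by (simp add: linear_0[OF f] linear_0[OF g])
    next
      case (step c x z)
      then show ?case by (auto simp: linear_add[OF f] linear_add[OF g] basis)
    qed
    then show "\<delta>' = \<delta>"
      using * \<delta> by (intro derivation_unique) (simp_all add: g_def)
  qed
qed

end

end

theory Submission
  imports Defs
begin

text \<open>
  A derivation that sends vectors to scalars sends a product of two vectors to a vector, so the
  partial derivatives of a quadratic Lagrangian lie in the copy of \<open>\<Lambda>\<close> in its symmetric algebra.
  This copy is closed under \<open>d/dt\<close> and real linear combinations, hence contains the Euler-Lagrange
  expressions; and a vector is a real linear combination of the derivatives of a flat output.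
\<close>

lemma subspace_range_sym_incl: "subspace (range sym_incl)"
  by (rule linear_subspace_image[OF linear_sym_incl subspace_UNIV])

text \<open>By the Leibniz rule, a product of two vectors goes to a combination of these vectors
  whose coefficients are the scalar values of \<delta> on them.\<close>

lemma derivation_sym_power_2:
  fixes \<delta> :: "'a::real_vector sym_alg \<Rightarrow> 'a sym_alg"
  assumes der: "derivation \<delta>" and scalar: "\<And>x. \<delta> (sym_incl x) \<in> \<real>" and a: "a \<in> sym_power 2"
  shows "\<delta> a \<in> range sym_incl"
proof -
  have lin: "linear \<delta>" and mult: "\<And>u v. \<delta> (u * v) = \<delta> u * v + u * \<delta> v"
    using der by (auto simp: derivation_def)
  have prod: "\<delta> (sym_incl x * sym_incl z) \<in> range sym_incl" for x z
  proof -
    obtain c d where "\<delta> (sym_incl x) = of_real c" "\<delta> (sym_incl z) = of_real d"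
      using scalar by (meson Reals_cases)
    then have "\<delta> (sym_incl x * sym_incl z) = c *\<^sub>R sym_incl z + d *\<^sub>R sym_incl x"
      by (simp add: mult scaleR_conv_of_real mult.commute)
    also have "\<dots> \<in> range sym_incl"
      by (intro subspace_add subspace_scale subspace_range_sym_incl rangeI)
    finally show ?thesis .
  qed
  \<comment> \<open>The products of two vectors span \<open>sym_power 2\<close>, and a linear map
    commutes with taking spans, so it is enough to treat these products.\<close>
  have "\<delta> ` sym_power 2 = span (\<delta> ` {prod_list (map sym_incl xs) | xs. length xs = 2})"
    unfolding sym_power_def by (rule linear_span_image[OF lin, symmetric])
  also have "\<dots> \<subseteq> range sym_incl"
  proof (rule span_minimal[OF _ subspace_range_sym_incl])
    show "\<delta> ` {prod_list (map sym_incl xs) | xs. length xs = 2} \<subseteq> range sym_incl"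
      by (auto simp: numeral_2_eq_2 length_Suc_conv prod)
  qed
  finally show ?thesis using a by blast
qed

context linear_system
begin

text \<open>Over \<open>real poly\<close> a vector is a combination of the flat output. Each
  coefficient is a polynomial in d/dt; its monomials act as scaled iterates of \<open>ddt\<close>,
  so its real coefficients are the numbers sought.\<close>

lemma flat_output_expansion:
  assumes "flat_output m y"
  obtains N :: nat and a :: "nat \<Rightarrow> nat \<Rightarrow> real"
  where "x = (\<Sum>j=1..m. \<Sum>k\<le>N. a j k *\<^sub>R (ddt ^^ k) (y j))"
proof -
  have inj: "inj_on y {1..m}" and sp: "x \<in> span (y ` {1..m})"
    using assms by (auto simp: flat_output_def)
  obtain u where "x = (\<Sum>v\<in>y ` {1..m}. smul (u v) v)"
    using sp span_finite[of "y ` {1..m}"] by auto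
  then have x: "x = (\<Sum>j=1..m. smul (u (y j)) (y j))"
    by (simp only: sum.reindex[OF inj] o_def)
  \<comment> \<open>A common bound for all the degrees, which also makes sense for
    \<open>m = 0\<close>; coefficients beyond the degree of a polynomial are zero and pad its sum up
    to \<open>N\<close>.\<close>
  define N where "N = (\<Sum>j=1..m. degree (u (y j)))"
  have "smul (u (y j)) (y j) = (\<Sum>k\<le>N. coeff (u (y j)) k *\<^sub>R (ddt ^^ k) (y j))"
    if "j \<in> {1..m}" for j
  proof -
    have "degree (u (y j)) \<le> N"
      unfolding N_def by (rule member_le_sum[OF that]) auto
    then have "u (y j) = (\<Sum>k\<le>N. monom (coeff (u (y j)) k) k)"
      by (rule poly_as_sum_of_monoms'[symmetric])
    then have "smul (u (y j)) (y j) = (\<Sum>k\<le>N. smul (monom (coeff (u (y j)) k) k) (y j))"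
      by (metis scale_sum_left)
    also have "\<dots> = (\<Sum>k\<le>N. coeff (u (y j)) k *\<^sub>R (ddt ^^ k) (y j))"
      by (simp add: ddt_power smul_const[symmetric] smult_monom)
    finally show ?thesis .
  qed
  with x have "x = (\<Sum>j=1..m. \<Sum>k\<le>N. coeff (u (y j)) k *\<^sub>R (ddt ^^ k) (y j))"
    by simp
  then show thesis by (rule that)
qed

lemma sym_incl_jets:
  assumes "flat_output m y"
  obtains N :: nat and a :: "nat \<Rightarrow> nat \<Rightarrow> real"
  where "sym_incl x = (\<Sum>j=1..m. \<Sum>k\<le>N. a j k *\<^sub>R jet y j k)"
proof -
  obtain N :: nat and a :: "nat \<Rightarrow> nat \<Rightarrow> real"
    where x: "x = (\<Sum>j=1..m. \<Sum>k\<le>N. a j k *\<^sub>R (ddt ^^ k) (y j))"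
    by (rule flat_output_expansion[OF assms])
  have "sym_incl x = (\<Sum>j=1..m. \<Sum>k\<le>N. a j k *\<^sub>R jet y j k)"
    by (subst x) (simp add: linear_sum[OF linear_sym_incl] linear_cmul[OF linear_sym_incl] jet_def)
  then show thesis by (rule that)
qed

lemma
  assumes "flat_output m y" and "i \<in> {1..m}"
  shows derivation_partial_jet: "derivation (partial_jet m y i k)"
    and partial_jet_jet: "j \<in> {1..m} \<Longrightarrow>
      partial_jet m y i k (jet y j l) = (if j = i \<and> l = k then 1 else 0)"
  using theI'[OF partial_jet_ex1[OF assms, of k]] unfolding partial_jet_def[symmetric] by blast+

text \<open>In the jet expansion of a vector only the term with indices \<open>i\<close> and
  \<open>k\<close> survives: the value is its coefficient, or 0 if \<open>k\<close> exceeds the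
  order \<open>N\<close>.\<close>

lemma partial_jet_sym_incl:
  assumes y: "flat_output m y" and i: "i \<in> {1..m}"
  shows "partial_jet m y i k (sym_incl x) \<in> \<real>"
proof -
  let ?\<delta> = "partial_jet m y i k"
  have lin: "linear ?\<delta>"
    using derivation_partial_jet[OF y i] by (simp add: derivation_def)
  obtain N :: nat and a :: "nat \<Rightarrow> nat \<Rightarrow> real"
    where x: "sym_incl x = (\<Sum>j=1..m. \<Sum>l\<le>N. a j l *\<^sub>R jet y j l)"
    by (rule sym_incl_jets[OF y])
  have "?\<delta> (sym_incl x) = (\<Sum>j=1..m. \<Sum>l\<le>N. a j l *\<^sub>R ?\<delta> (jet y j l))"
    unfolding x by (simp only: linear_sum[OF lin] linear_cmul[OF lin])
  also have "\<dots> \<in> \<real>"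
    by (intro sum_in_Reals) (simp add: partial_jet_jet[OF y i] scaleR_conv_of_real)
  finally show ?thesis .
qed

lemma ddt_sym_sym_incl: "ddt_sym (sym_incl x) = sym_incl (ddt x)"
  using theI'[OF ddt_sym_ex1] unfolding ddt_sym_def[symmetric] by blast

lemma ddt_sym_power_sym_incl: "(ddt_sym ^^ k) (sym_incl x) = sym_incl ((ddt ^^ k) x)"
  by (induction k) (simp_all add: ddt_sym_sym_incl)

lemma euler_lagrange_sym_power_2:
  assumes y: "flat_output m y" and i: "i \<in> {1..m}" and L: "L \<in> sym_power 2"
  shows "euler_lagrange m y \<mu> L i \<in> range sym_incl"
proof -
  have "(-1) ^ k * (ddt_sym ^^ k) (partial_jet m y i k L) \<in> range sym_incl" for k
  proof -
    obtain x where "partial_jet m y i k L = sym_incl x"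
      using derivation_sym_power_2[OF derivation_partial_jet[OF y i] partial_jet_sym_incl[OF y i] L]
      by blast
    \<comment> \<open>The sign, an element of the symmetric algebra, is read as a real scalar so
      that closure under scaling applies.\<close>
    then have "(-1) ^ k * (ddt_sym ^^ k) (partial_jet m y i k L)
        = (-1) ^ k *\<^sub>R sym_incl ((ddt ^^ k) x)"
      by (simp add: ddt_sym_power_sym_incl scaleR_conv_of_real)
    also have "\<dots> \<in> range sym_incl"
      by (intro real_vector.subspace_scale subspace_range_sym_incl rangeI)
    finally show ?thesis .
  qed
  then show ?thesis
    unfolding euler_lagrange_def
    by (intro real_vector.subspace_sum subspace_range_sym_incl)
qed

text \<open>Each expression is a single vector of \<Lambda>, so its jet expansion has constant
  coefficients and no constant term, which is homogeneity.\<close>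

lemma euler_lagrange_homogeneous_linear:
  assumes y: "flat_output m y" and L: "L \<in> sym_power 2"
  shows "homogeneous_linear_const_system m y (euler_lagrange m y \<mu> L)"
  unfolding homogeneous_linear_const_system_def
proof
  fix i assume "i \<in> {1..m}"
  then obtain x where "euler_lagrange m y \<mu> L i = sym_incl x"
    using euler_lagrange_sym_power_2[OF y _ L] by blast
  then show "\<exists>(N::nat) (a :: nat \<Rightarrow> nat \<Rightarrow> real).
      euler_lagrange m y \<mu> L i = (\<Sum>j=1..m. \<Sum>k\<le>N. a j k *\<^sub>R jet y j k)"
    by (metis sym_incl_jets[OF y])
qed

end

theorem corollary13:
  fixes smul :: "real poly \<Rightarrow> 'a::real_vector \<Rightarrow> 'a"
    and m :: nat and y :: "nat \<Rightarrow> 'a"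
    and \<mu> :: "nat \<Rightarrow> nat" and L :: "'a sym_alg"
  assumes "linear_system smul"
    and "linear_system.controllable smul"
    and "linear_system.flat_output smul m y"
    and "L \<in> subalgebra_generated {linear_system.jet smul y j k | j k. j \<in> {1..m} \<and> k \<le> \<mu> j}"
    and "L \<in> sym_power 2"
  shows "linear_system.homogeneous_linear_const_system smul m y
           (linear_system.euler_lagrange smul m y \<mu> L)"
  by (rule linear_system.euler_lagrange_homogeneous_linear[OF assms(1,3,5)])

end
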